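(* Let $G'$ be a connected graph with $\lambda_1(G')>2$, and let $X=G'\square_\sigma H_r$ be an $H_r$-bundle over $G'$. For $1\le m\le r$, $X$ is $H_r$-bundle isomorphic to $B\,\square\,H_m$, where $B$ is an $H_{r-m}$-bundle over $G'$, if and only if there exist $m$ linearly independent $2$-eigenvectors $f_1,\dots,f_m$ of $X$ such that $f_i(V(X))\subseteq\{-1,1\}$ for $1\le i\le m$.
   Context: All graphs are simple, finite and unweighted. For $f:V(X)\to\mathbb{R}$ put $Lf(x)=\sum_{y\sim x}(f(y)-f(x))$; $\lambda_1$ is the smallest nonzero eigenvalue of $-L$ on a connected graph. A $2$-eigenvector of $X$ is a nonzero $f:V(X)\to\mathbb{R}$ with $Lf=-2f$. $H_r$ is the $r$-dimensional hypercube: vertex set $\mathbb{F}_2^r$, two vertices adjacent iff they differ in exactly one coordinate ($H_0$ is the one-vertex graph). $\square$ denotes the Cartesian product of graphs. Graph bundles: given graphs $G',F$ and a map $\sigma$ assigning to each oriented edge $(x,y)$ of $G'$ an automorphism $\sigma_{xy}\in\operatorname{Aut}(F)$ with $\sigma_{yx}=\sigma_{xy}^{-1}$, the $F$-bundle $G'\square_\sigma F$ over $G'$ has vertex set $V(G')\times V(F)$ and edges $(x,u)\sim(y,\sigma_{xy}(u))$ whenever $x\sim y$ in $G'$, and $(x,u)\sim(x,v)$ whenever $u\sim v$ in $F$. Two $F$-bundles $G'\square_{\sigma_1}F$ and $G'\square_{\sigma_2}F$ are $F$-bundle isomorphic if there is a graph isomorphism $\Psi$ between them with $\pi\circ\Psi=\pi$,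 where $\pi$ denotes the projection to $V(G')$. If $B=G'\square_\rho H_{r-m}$, then $B\,\square\,H_m$ is regarded as an $H_r$-bundle over $G'$ via $H_r=H_{r-m}\square H_m$, i.e. as the bundle with transition maps $(v,w)\mapsto(\rho_{xy}(v),w)$. *)

theory Defs
  imports
    Complex_Main
    "HOL-Library.Extended_Real"
    "HOL-Library.Z2"
    "Graph_Theory.Graph_Theory"
begin

text \<open>
  A simple finite graph is a \<^const>\<open>pair_graph\<close>: a finite vertex set \<open>pverts G\<close> with a symmetric,
  irreflexive set \<open>parcs G\<close> of ordered pairs, so that \<open>(x, y) \<in> parcs G\<close> is adjacency and each
  edge occurs with both orientations. Functions on the vertices are total functions on the vertex
  type of which only the values on \<open>pverts G\<close> are ever used.
\<close>

section \<open>Laplacian and eigenvectors\<close>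

definition laplacian :: "'a pair_pre_digraph \<Rightarrow> ('a \<Rightarrow> real) \<Rightarrow> 'a \<Rightarrow> real" where
  "laplacian G f x = (\<Sum>y \<in> {y. (x, y) \<in> parcs G}. f y - f x)"

definition eigenvector :: "'a pair_pre_digraph \<Rightarrow> real \<Rightarrow> ('a \<Rightarrow> real) \<Rightarrow> bool" where
  "eigenvector G l f \<longleftrightarrow>
     (\<exists>x \<in> pverts G. f x \<noteq> 0) \<and> (\<forall>x \<in> pverts G. laplacian G f x = - l * f x)"

text \<open>
  The infimum is over a finite set, hence a minimum, except for the one-vertex graph: there is no
  nonzero eigenvalue then, and the value is \<open>\<infinity>\<close>.
\<close>

definition lambda1 :: "'a pair_pre_digraph \<Rightarrow> ereal" where
  "lambda1 G = (INF l \<in> {l. l \<noteq> 0 \<and> (\<exists>f. eigenvector G l f)}. ereal l)"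

definition lin_indep_on :: "'a set \<Rightarrow> 'i set \<Rightarrow> ('i \<Rightarrow> 'a \<Rightarrow> real) \<Rightarrow> bool" where
  "lin_indep_on V I f \<longleftrightarrow>
     (\<forall>c. (\<forall>x \<in> V. (\<Sum>i \<in> I. c i * f i x) = 0) \<longrightarrow> (\<forall>i \<in> I. c i = 0))"

section \<open>Hypercubes, products and isomorphisms\<close>

definition hypercube :: "nat \<Rightarrow> bit list pair_pre_digraph" where
  "hypercube r =
     \<lparr> pverts = {v. length v = r},
       parcs = {(u, v). length u = r \<and> length v = r \<and> (\<exists>!i. i < r \<and> u ! i \<noteq> v ! i)} \<rparr>"

lemma pverts_hypercube: "pverts (hypercube r) = {v. length v = r}"
  by (simp add: hypercube_def)

definition cart_prod ::
  "'a pair_pre_digraph \<Rightarrow> 'b pair_pre_digraph \<Rightarrow> ('a \<times> 'b) pair_pre_digraph" (infixr \<open>\<box>\<close> 70) where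
  "G \<box> H =
     \<lparr> pverts = pverts G \<times> pverts H,
       parcs = {((x, u), (y, v)).
         ((x, y) \<in> parcs G \<and> u = v \<and> u \<in> pverts H) \<or>
         (x = y \<and> x \<in> pverts G \<and> (u, v) \<in> parcs H)} \<rparr>"

definition graph_isomorphism ::
  "'a pair_pre_digraph \<Rightarrow> 'b pair_pre_digraph \<Rightarrow> ('a \<Rightarrow> 'b) \<Rightarrow> bool" where
  "graph_isomorphism G H h \<longleftrightarrow>
     bij_betw h (pverts G) (pverts H) \<and>
     (\<forall>x \<in> pverts G. \<forall>y \<in> pverts G. (h x, h y) \<in> parcs H \<longleftrightarrow> (x, y) \<in> parcs G)"

section \<open>Graph bundles\<close>

definition transition_maps ::
  "'a pair_pre_digraph \<Rightarrow> 'f pair_pre_digraph \<Rightarrow> ('a \<Rightarrow> 'a \<Rightarrow> 'f \<Rightarrow> 'f) \<Rightarrow> bool" where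
  "transition_maps G F \<sigma> \<longleftrightarrow>
     (\<forall>(x, y) \<in> parcs G.
        graph_isomorphism F F (\<sigma> x y) \<and> (\<forall>u \<in> pverts F. \<sigma> y x (\<sigma> x y u) = u))"

definition graph_bundle ::
  "'a pair_pre_digraph \<Rightarrow> ('a \<Rightarrow> 'a \<Rightarrow> 'f \<Rightarrow> 'f) \<Rightarrow> 'f pair_pre_digraph \<Rightarrow>
   ('a \<times> 'f) pair_pre_digraph" where
  "graph_bundle G \<sigma> F =
     \<lparr> pverts = pverts G \<times> pverts F,
       parcs = {((x, u), (y, \<sigma> x y u)) | x y u. (x, y) \<in> parcs G \<and> u \<in> pverts F} \<union>
               {((x, u), (x, v)) | x u v. x \<in> pverts G \<and> (u, v) \<in> parcs F} \<rparr>"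

text \<open>The projection of a bundle to its base graph is \<^const>\<open>fst\<close>.\<close>

definition bundle_isomorphic ::
  "('a \<times> 'f) pair_pre_digraph \<Rightarrow> ('a \<times> 'f) pair_pre_digraph \<Rightarrow> bool" where
  "bundle_isomorphic X Y \<longleftrightarrow>
     (\<exists>\<Psi>. graph_isomorphism X Y \<Psi> \<and> (\<forall>p \<in> pverts X. fst (\<Psi> p) = fst p))"

text \<open>
  The identification \<open>H\<^bsub>k\<^esub> \<box> H\<^bsub>m\<^esub> = H\<^bsub>k + m\<^esub>\<close> is concatenation of coordinate lists. It turns the
  product \<open>B \<box> H\<^bsub>m\<^esub>\<close> of an \<open>H\<^bsub>k\<^esub>\<close>-bundle \<open>B\<close> over \<open>G\<close> with \<open>H\<^bsub>m\<^esub>\<close> into a graph on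
  \<open>V(G) \<times> V(H\<^bsub>k + m\<^esub>)\<close>; the lemmas below show that the result is the \<open>H\<^bsub>k + m\<^esub>\<close>-bundle
  over \<open>G\<close> with transition maps \<open>(v, w) \<mapsto> (\<rho>\<^bsub>xy\<^esub>(v), w)\<close>.
\<close>

definition regroup :: "('a \<times> bit list) \<times> bit list \<Rightarrow> 'a \<times> bit list" where
  "regroup = (\<lambda>((x, v), w). (x, v @ w))"

definition as_cube_bundle ::
  "(('a \<times> bit list) \<times> bit list) pair_pre_digraph \<Rightarrow> ('a \<times> bit list) pair_pre_digraph" where
  "as_cube_bundle Y =
     \<lparr> pverts = regroup ` pverts Y, parcs = map_prod regroup regroup ` parcs Y \<rparr>"

definition extend_transition ::
  "nat \<Rightarrow> ('a \<Rightarrow> 'a \<Rightarrow> bit list \<Rightarrow> bit list) \<Rightarrow> 'a \<Rightarrow> 'a \<Rightarrow> bit list \<Rightarrow> bit list" where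
  "extend_transition k \<rho> x y z = \<rho> x y (take k z) @ drop k z"

lemma hypercube_append_adj:
  assumes "length a = k" "length c = k" "length b = m" "length d = m"
  shows "(a @ b, c @ d) \<in> parcs (hypercube (k + m)) \<longleftrightarrow>
    (a, c) \<in> parcs (hypercube k) \<and> b = d \<or> a = c \<and> (b, d) \<in> parcs (hypercube m)"
proof -
  define A where "A = {i. i < k \<and> a ! i \<noteq> c ! i}"
  define B where "B = {i. i < m \<and> b ! i \<noteq> d ! i}"
  define C where "C = {i. i < k + m \<and> (a @ b) ! i \<noteq> (c @ d) ! i}"
  have ex1: "(\<exists>!i. P i) \<longleftrightarrow> card {i. P i} = 1" for P :: "nat \<Rightarrow> bool"
    unfolding One_nat_def card_1_singleton_iff set_eq_iff mem_Collect_eq singleton_iff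
    by (rule iffI) (blast, metis)
  have C: "C = A \<union> (\<lambda>i. k + i) ` B"
  proof (intro equalityI subsetI)
    fix i assume i: "i \<in> C"
    show "i \<in> A \<union> (\<lambda>i. k + i) ` B"
    proof (cases "i < k")
      case True
      with i show ?thesis using assms by (auto simp: C_def A_def nth_append)
    next
      case False
      then obtain j where "i = k + j" by (metis le_Suc_ex not_less)
      with i show ?thesis using assms by (auto simp: C_def B_def nth_append)
    qed
  qed (use assms in \<open>auto simp: A_def B_def C_def nth_append\<close>)
  have fin: "finite A" "finite B" by (auto simp: A_def B_def)
  have "A \<inter> (\<lambda>i. k + i) ` B = {}" by (auto simp: A_def)
  hence card: "card C = card A + card B"
    unfolding C using fin by (subst card_Un_disjoint) (auto simp: card_image)
  have eqA: "a = c \<longleftrightarrow> card A = 0"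
    using fin assms by (auto simp: A_def list_eq_iff_nth_eq)
  have eqB: "b = d \<longleftrightarrow> card B = 0"
    using fin assms by (auto simp: B_def list_eq_iff_nth_eq)
  have "(a, c) \<in> parcs (hypercube k) \<longleftrightarrow> card A = 1"
    "(b, d) \<in> parcs (hypercube m) \<longleftrightarrow> card B = 1"
    "(a @ b, c @ d) \<in> parcs (hypercube (k + m)) \<longleftrightarrow> card C = 1"
    using assms by (simp_all add: hypercube_def ex1 A_def B_def C_def)
  thus ?thesis unfolding eqA eqB card by linarith
qed

lemma transition_maps_hypercube_length:
  assumes "transition_maps G (hypercube k) \<rho>" "(x, y) \<in> parcs G" "length v = k"
  shows "length (\<rho> x y v) = k"
proof -
  have "bij_betw (\<rho> x y) {v. length v = k} {v. length v = k}"
    using assms by (auto simp: transition_maps_def graph_isomorphism_def pverts_hypercube)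
  thus ?thesis using assms(3) bij_betwE by blast
qed

lemma as_cube_bundle_eq:
  assumes "transition_maps G (hypercube k) \<rho>"
  shows "as_cube_bundle (graph_bundle G \<rho> (hypercube k) \<box> hypercube m) =
    graph_bundle G (extend_transition k \<rho>) (hypercube (k + m))" (is "?L = ?R")
proof -
  note len = transition_maps_hypercube_length[OF assms]
  have split: "\<exists>a b. z = a @ b \<and> length a = k \<and> length b = m" if "length z = k + m" for z :: "bit list"
    using that by (intro exI[of _ "take k z"] exI[of _ "drop k z"]) auto
  have V: "pverts ?L = pverts ?R"
  proof -
    have "regroup ` pverts (graph_bundle G \<rho> (hypercube k) \<box> hypercube m) =
      pverts G \<times> {z. length z = k + m}" (is "?A = ?B")
    proof
      show "?A \<subseteq> ?B"
        by (auto simp: cart_prod_def graph_bundle_def regroup_def pverts_hypercube)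
      show "?B \<subseteq> ?A"
      proof clarify
        fix x and z :: "bit list" assume x: "x \<in> pverts G" and "length z = k + m"
        then obtain a b where z: "z = a @ b" "length a = k" "length b = m" using split by blast
        have "((x, a), b) \<in> pverts (graph_bundle G \<rho> (hypercube k) \<box> hypercube m)"
          using x z by (simp add: cart_prod_def graph_bundle_def pverts_hypercube)
        moreover have "(x, z) = regroup ((x, a), b)" using z by (simp add: regroup_def)
        ultimately show "(x, z) \<in> ?A" by blast
      qed
    qed
    thus ?thesis by (simp add: as_cube_bundle_def graph_bundle_def pverts_hypercube)
  qed
  have sub: "parcs ?L \<subseteq> parcs ?R"
  proof
    fix e assume "e \<in> parcs ?L"
    then obtain x a b y c d where e: "e = ((x, a @ b), (y, c @ d))"
      and adj: "(((x, a), b), ((y, c), d)) \<in> parcs (graph_bundle G \<rho> (hypercube k) \<box> hypercube m)"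
      by (auto simp: as_cube_bundle_def regroup_def)
    from adj consider
      (base) "(x, y) \<in> parcs G" "length a = k" "c = \<rho> x y a" "b = d" "length b = m"
      | (fib1) "x = y" "x \<in> pverts G" "(a, c) \<in> parcs (hypercube k)" "b = d" "length b = m"
      | (fib2) "x = y" "x \<in> pverts G" "a = c" "length a = k" "(b, d) \<in> parcs (hypercube m)"
      by (auto simp: cart_prod_def graph_bundle_def hypercube_def)
    thus "e \<in> parcs ?R"
    proof cases
      case base
      thus ?thesis unfolding e graph_bundle_def
        by (auto simp: extend_transition_def hypercube_def)
    next
      case fib1
      hence "(a @ b, c @ d) \<in> parcs (hypercube (k + m))"
        by (subst hypercube_append_adj) (auto simp: hypercube_def)
      thus ?thesis using fib1 unfolding e graph_bundle_def by auto
    next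
      case fib2
      hence "(a @ b, c @ d) \<in> parcs (hypercube (k + m))"
        by (subst hypercube_append_adj) (auto simp: hypercube_def)
      thus ?thesis using fib2 unfolding e graph_bundle_def by auto
    qed
  qed
  have sup: "parcs ?R \<subseteq> parcs ?L"
  proof
    fix e assume "e \<in> parcs ?R"
    then consider
      (base) x y z where "e = ((x, z), (y, extend_transition k \<rho> x y z))" "(x, y) \<in> parcs G"
        "length z = k + m"
      | (fib) x z z' where "e = ((x, z), (x, z'))" "x \<in> pverts G"
        "(z, z') \<in> parcs (hypercube (k + m))"
      by (auto simp: graph_bundle_def pverts_hypercube)
    thus "e \<in> parcs ?L"
    proof cases
      case base
      obtain a b where z: "z = a @ b" "length a = k" "length b = m"
        using split[OF base(3)] by blast
      have "(((x, a), b), ((y, \<rho> x y a), b)) \<in> parcs (graph_bundle G \<rho> (hypercube k) \<box> hypercube m)"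
        using base z by (auto simp: cart_prod_def graph_bundle_def hypercube_def)
      hence "map_prod regroup regroup (((x, a), b), ((y, \<rho> x y a), b)) \<in> parcs ?L"
        by (auto simp: as_cube_bundle_def simp del: map_prod_simp)
      thus ?thesis using base z by (simp add: regroup_def extend_transition_def)
    next
      case fib
      hence l: "length z = k + m" "length z' = k + m" by (auto simp: hypercube_def)
      obtain a b where z: "z = a @ b" "length a = k" "length b = m" using split[OF l(1)] by blast
      obtain c d where z': "z' = c @ d" "length c = k" "length d = m" using split[OF l(2)] by blast
      have "(a, c) \<in> parcs (hypercube k) \<and> b = d \<or> a = c \<and> (b, d) \<in> parcs (hypercube m)"
        using fib(3) z z' hypercube_append_adj by blast
      hence "(((x, a), b), ((x, c), d)) \<in> parcs (graph_bundle G \<rho> (hypercube k) \<box> hypercube m)"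
        using fib(2) z z' by (auto simp: cart_prod_def graph_bundle_def hypercube_def)
      hence "map_prod regroup regroup (((x, a), b), ((x, c), d)) \<in> parcs ?L"
        by (auto simp: as_cube_bundle_def simp del: map_prod_simp)
      thus ?thesis using fib z z' by (simp add: regroup_def)
    qed
  qed
  show ?thesis using V equalityI[OF sub sup] by (intro pair_pre_digraph.equality) (assumption+, simp)
qed

lemma transition_maps_extend:
  assumes "pair_graph G" "transition_maps G (hypercube k) \<rho>"
  shows "transition_maps G (hypercube (k + m)) (extend_transition k \<rho>)"
proof -
  interpret pair_graph G by fact
  note len = transition_maps_hypercube_length[OF assms(2)]
  let ?e = "extend_transition k \<rho>"
  show ?thesis unfolding transition_maps_def
  proof (safe)
    fix x y assume xy: "(x, y) \<in> parcs G"
    have yx: "(y, x) \<in> parcs G"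
      using pair_sym_arcs xy by (auto simp: symmetric_def dest: symD)
    have cancel: "?e q p (?e p q z) = z" and l: "length (?e p q z) = k + m"
      if "length z = k + m" "(p, q) \<in> parcs G" for p q z
      using assms(2) that len[OF that(2), of "take k z"]
      by (auto simp: transition_maps_def extend_transition_def hypercube_def split: prod.splits)
    show "\<And>u. u \<in> pverts (hypercube (k + m)) \<Longrightarrow> ?e y x (?e x y u) = u"
      using cancel xy by (auto simp: hypercube_def)
    have bij: "bij_betw (?e x y) (pverts (hypercube (k + m))) (pverts (hypercube (k + m)))"
      by (rule bij_betw_byWitness[where f' = "?e y x"])
        (use cancel l xy yx in \<open>auto simp: hypercube_def\<close>)
    have iso: "graph_isomorphism (hypercube k) (hypercube k) (\<rho> x y)"
      using assms(2) xy by (auto simp: transition_maps_def)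
    have "(?e x y z, ?e x y z') \<in> parcs (hypercube (k + m)) \<longleftrightarrow> (z, z') \<in> parcs (hypercube (k + m))"
      if "length z = k + m" "length z' = k + m" for z z'
    proof -
      let ?a = "take k z" and ?b = "drop k z" and ?c = "take k z'" and ?d = "drop k z'"
      have ln: "length ?a = k" "length ?c = k" "length ?b = m" "length ?d = m" using that by auto
      have "(\<rho> x y ?a, \<rho> x y ?c) \<in> parcs (hypercube k) \<longleftrightarrow> (?a, ?c) \<in> parcs (hypercube k)"
        using iso ln by (auto simp: graph_isomorphism_def hypercube_def)
      moreover have "\<rho> x y ?a = \<rho> x y ?c \<longleftrightarrow> ?a = ?c"
        using iso ln inj_on_eq_iff[of "\<rho> x y" "pverts (hypercube k)" ?a ?c]
        by (simp add: graph_isomorphism_def bij_betw_def hypercube_def)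
      ultimately show ?thesis
        using hypercube_append_adj[OF ln]
          hypercube_append_adj[OF len[OF xy ln(1)] len[OF xy ln(2)] ln(3,4)]
        unfolding extend_transition_def append_take_drop_id by blast
    qed
    with bij show "graph_isomorphism (hypercube (k + m)) (hypercube (k + m)) (?e x y)"
      by (auto simp: graph_isomorphism_def hypercube_def)
  qed
qed

end

theory Submission
  imports Defs
begin

text \<open>
  Let \<open>f\<close> be a function on \<open>X\<close> with values \<open>1\<close> and \<open>-1\<close>. Every edge at a vertex \<open>p\<close> contributes
  \<open>0\<close> or \<open>-2 f p\<close> to the Laplacian, so \<open>f\<close> is a \<open>2\<close>-eigenvector exactly when every vertex has
  exactly one neighbour of the opposite sign. The theorem comes from combining this count with the
  spectral gap of the base graph.

  Summing a \<open>2\<close>-eigenvector over the fibres gives a function on the base with the same eigenvalue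
  equation, because the transition maps permute the fibre and the fibre Laplacian sums to zero. As
  \<open>\<lambda>\<^sub>1 > 2\<close>, this function vanishes (\<open>fibre_sums_eq_0\<close>), so \<open>f\<close> changes sign on every fibre. A
  two-valued function on a cube that is not constant and changes sign along at most one edge at each
  vertex is a signed coordinate \<open>u \<mapsto> \<plusminus>(-1)\<^bsup>u\<^sub>s\<^esup>\<close>
  (\<open>signed_coordinate_if_sparse_sign_changes\<close>). Hence the single opposite neighbour of each vertex
  already lies in its own fibre, and \<open>f\<close> does not change along any horizontal edge
  (\<open>pm_eigenvector_rigidity\<close>).

  Given \<open>m\<close> independent eigenvectors of this kind, two of them never use the same coordinate on a
  fibre: they would agree up to sign there, and horizontal constancy would carry this relation over
  the connected base. So on each fibre some automorphism of the cube, a signed permutation of the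
  coordinates, turns the eigenvectors into the signs of the last \<open>m\<close> coordinates. After this change
  of fibre coordinates the transition maps fix the last \<open>m\<close> coordinates, and an automorphism of the
  cube with this property acts on the remaining coordinates independently of them
  (\<open>automorphism_fixing_last_coordinates\<close>). This is the required splitting
  (\<open>cube_factor_if_eigenvectors\<close>). In the other direction the signs of the coordinates of the
  factor \<open>H\<^sub>m\<close> are the eigenvectors (\<open>eigenvectors_if_cube_factor\<close>).
\<close>
section \<open>Walking through the hypercube\<close>

definition flip :: "nat \<Rightarrow> bit list \<Rightarrow> bit list" where
  "flip i u = u[i := u ! i + 1]"

definition bit_sign :: "bit \<Rightarrow> real" where
  "bit_sign b = (if b = 0 then 1 else -1)"

lemma length_flip [simp]: "length (flip i u) = length u"
  by (simp add: flip_def)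

lemma nth_flip: "i < length u \<Longrightarrow> flip i u ! j = (if i = j then u ! j + 1 else u ! j)"
  by (simp add: flip_def nth_list_update)

lemma bit_add_1_neq: "b + 1 \<noteq> b" for b :: bit
  by (cases b) simp_all

lemma flip_flip: "i < length u \<Longrightarrow> flip i (flip i u) = u"
  by (rule nth_equalityI) (auto simp: nth_flip add.assoc)

lemma flip_commute: "i < length u \<Longrightarrow> j < length u \<Longrightarrow> flip i (flip j u) = flip j (flip i u)"
  by (rule nth_equalityI) (auto simp: nth_flip)

lemma flip_neq: "i < length u \<Longrightarrow> flip i u \<noteq> u"
  by (metis nth_flip bit_add_1_neq)

lemma inj_on_flip: "length u = r \<Longrightarrow> inj_on (\<lambda>i. flip i u) {..<r}"
  by (rule inj_onI) (metis bit_add_1_neq lessThan_iff nth_flip)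

lemma bit_sign_add_1: "bit_sign (b + 1) = - bit_sign b"
  by (cases b) (simp_all add: bit_sign_def)

lemma bit_sign_add: "bit_sign (a + b) = bit_sign a * bit_sign b"
  by (cases a; cases b) (simp_all add: bit_sign_def)

lemma bit_sign_pm1: "bit_sign b \<in> {-1, 1}"
  by (simp add: bit_sign_def)

lemma bit_sign_eq_iff: "bit_sign a = bit_sign b \<longleftrightarrow> a = b"
  by (cases a; cases b) (simp_all add: bit_sign_def)

lemma hypercube_arc_iff:
  "(u, v) \<in> parcs (hypercube r) \<longleftrightarrow> length u = r \<and> (\<exists>i<r. v = flip i u)"
proof
  assume "(u, v) \<in> parcs (hypercube r)"
  hence u: "length u = r" and v: "length v = r" and ex: "\<exists>!i. i < r \<and> u ! i \<noteq> v ! i"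
    by (simp_all add: hypercube_def)
  obtain i where i: "i < r" "u ! i \<noteq> v ! i"
    and uniq: "\<And>j. j < r \<Longrightarrow> u ! j \<noteq> v ! j \<Longrightarrow> j = i"
    using ex by blast
  have vi: "v ! i = u ! i + 1" using i(2) by (cases "u ! i"; cases "v ! i") simp_all
  have "v = flip i u"
  proof (rule nth_equalityI)
    fix j assume "j < length v"
    hence "j = i \<or> u ! j = v ! j" using uniq v by blast
    thus "v ! j = flip i u ! j" using u i(1) vi nth_flip[of i u j] by (cases "i = j") simp_all
  qed (simp add: u v)
  thus "length u = r \<and> (\<exists>i<r. v = flip i u)" using u i by blast
next
  assume "length u = r \<and> (\<exists>i<r. v = flip i u)"
  then obtain i where u: "length u = r" and i: "i < r" and v: "v = flip i u" by blast
  have differ: "u ! j \<noteq> v ! j \<longleftrightarrow> j = i" for j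
    using u i v bit_add_1_neq[of "u ! j"] by (auto simp: nth_flip)
  have "\<exists>!j. j < r \<and> u ! j \<noteq> v ! j"
    unfolding differ using i by blast
  thus "(u, v) \<in> parcs (hypercube r)" using u v by (simp add: hypercube_def)
qed

lemma finite_bit_lists: "finite {v :: bit list. length v = r}"
proof -
  have "b \<in> {0, 1}" for b :: bit by (cases b) simp_all
  hence "UNIV = {0, 1 :: bit}" by blast
  hence "finite (UNIV :: bit set)" by (rule ssubst) (simp only: finite.emptyI finite_insert)
  from finite_lists_length_eq[OF this, of r] show ?thesis by simp
qed

lemma pair_graph_hypercube: "pair_graph (hypercube r)"
proof
  let ?A = "parcs (hypercube r)"
  have sub: "?A \<subseteq> {v. length v = r} \<times> {v. length v = r}"
    by (auto simp: hypercube_def)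
  show "fst e \<in> pverts (hypercube r)" "snd e \<in> pverts (hypercube r)" if "e \<in> ?A" for e
    using subsetD[OF sub that] by (simp_all add: pverts_hypercube mem_Times_iff)
  show "fst e \<noteq> snd e" if "e \<in> ?A" for e
    using that by (cases e) (simp add: hypercube_def, blast)
  show "finite (pverts (hypercube r))"
    by (simp add: pverts_hypercube finite_bit_lists)
  show "finite ?A"
    using finite_subset[OF sub finite_cartesian_product[OF finite_bit_lists finite_bit_lists]] .
  have "sym ?A"
    unfolding sym_def hypercube_arc_iff by (metis flip_flip length_flip)
  thus "symmetric (with_proj (hypercube r))"
    by (simp add: symmetric_def)
qed

lemma laplacian_hypercube:
  assumes "length u = r"
  shows "laplacian (hypercube r) g u = (\<Sum>i<r. g (flip i u) - g u)"
proof -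
  have "{v. (u, v) \<in> parcs (hypercube r)} = (\<lambda>i. flip i u) ` {..<r}"
    using assms by (auto simp: hypercube_arc_iff)
  thus ?thesis
    by (simp add: laplacian_def sum.reindex[OF inj_on_flip[OF assms]])
qed

text \<open>
  Connectedness of the cube as an induction rule: the intermediate vertices take their first \<open>k\<close>
  coordinates from \<open>v\<close> and the others from \<open>u\<close>.
\<close>
lemma cube_flip_induct [consumes 2, case_names base step]:
  assumes "length u = r" "length v = r"
    and "P u"
    and step: "\<And>w i. length w = r \<Longrightarrow> i < r \<Longrightarrow> P w \<Longrightarrow> P (flip i w)"
  shows "P v"
proof -
  have nth: "(take k v @ drop k u) ! i = (if i < k then v ! i else u ! i)"
    if "k \<le> r" "i < r" for k i
    using that assms(1,2) by (simp add: nth_append)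
  have "P (take k v @ drop k u)" if "k \<le> r" for k
    using that
  proof (induction k)
    case 0
    show ?case using \<open>P u\<close> by simp
  next
    case (Suc k)
    let ?w = "take k v @ drop k u" and ?w' = "take (Suc k) v @ drop (Suc k) u"
    have k: "k < r" "k \<le> r" "Suc k \<le> r" using Suc.prems by simp_all
    have len: "length ?w = r" "length ?w' = r" using assms(1,2) k by simp_all
    have "P ?w" using Suc.IH k by blast
    show ?case
    proof (cases "u ! k = v ! k")
      case True
      have "?w' = ?w"
      proof (rule nth_equalityI)
        fix i assume "i < length ?w'"
        hence "i < r" by (simp only: len)
        thus "?w' ! i = ?w ! i"
          using True nth[OF k(3), of i] nth[OF k(2), of i] by (cases "i = k") simp_all
      qed (simp only: len)
      thus ?thesis using \<open>P ?w\<close> by (simp only:)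
    next
      case False
      hence v: "v ! k = u ! k + 1" by (cases "u ! k"; cases "v ! k") simp_all
      have "?w' = flip k ?w"
      proof (rule nth_equalityI)
        fix i assume "i < length ?w'"
        hence "i < r" by (simp only: len)
        thus "?w' ! i = flip k ?w ! i"
          using nth[OF k(3), of i] nth[OF k(2), of i] nth_flip[of k ?w i] len(1) k(1) v
          by (cases "i = k") simp_all
      qed (simp only: len length_flip)
      thus ?thesis using step[OF len(1) k(1) \<open>P ?w\<close>] by (simp only:)
    qed
  qed
  from this[of r] show ?thesis using assms(1,2) by simp
qed

text \<open>
  If \<open>g\<close> changes sign in direction \<open>s\<close> at \<open>w\<close>, then by sparseness it does not change in another
  direction \<open>i\<close>, neither at \<open>w\<close> nor at the vertex across the edge in direction \<open>s\<close>. So the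
  parallel edge at the vertex reached in direction \<open>i\<close> is again a sign change. Since the cube is
  connected, direction \<open>s\<close> changes the sign everywhere, and no other direction ever does.
\<close>
lemma signed_coordinate_if_sparse_sign_changes:
  fixes g :: "bit list \<Rightarrow> real"
  assumes pm: "\<And>u. length u = r \<Longrightarrow> g u \<in> {-1, 1}"
    and sparse: "\<And>u i j. length u = r \<Longrightarrow> i < r \<Longrightarrow> j < r \<Longrightarrow>
      g (flip i u) \<noteq> g u \<Longrightarrow> g (flip j u) \<noteq> g u \<Longrightarrow> i = j"
    and nonconst: "length a = r" "length b = r" "g a \<noteq> g b"
  shows "\<exists>s<r. \<exists>e. \<forall>u. length u = r \<longrightarrow> g u = bit_sign (u ! s + e)"
proof -
  obtain u0 s where u0: "length u0 = r" and s: "s < r" and change: "g (flip s u0) \<noteq> g u0"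
  proof (rule ccontr)
    assume "\<not> thesis"
    hence const: "g (flip i u) = g u" if "length u = r" "i < r" for u i
      using that \<open>\<And>s u0. \<lbrakk>length u0 = r; s < r; g (flip s u0) \<noteq> g u0\<rbrakk> \<Longrightarrow> thesis\<close> by blast
    from nonconst(1,2) have "g b = g a"
      by (induction rule: cube_flip_induct) (simp_all add: const)
    thus False using nonconst(3) by simp
  qed
  have all: "g (flip s u) \<noteq> g u" if "length u = r" for u
    using u0 that
  proof (induction rule: cube_flip_induct)
    case base
    show ?case by (rule change)
  next
    case (step w i)
    show ?case
    proof (cases "i = s")
      case True
      thus ?thesis using step s by (simp add: flip_flip)
    next
      case False
      have "g (flip i w) = g w"
        using sparse[of w i s] step False s by blast
      moreover have "g (flip i (flip s w)) = g (flip s w)"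
        using sparse[of "flip s w" i s] step False s by (fastforce simp: flip_flip)
      ultimately show ?thesis using step s by (simp add: flip_commute[of s w i])
    qed
  qed
  let ?o = "replicate r (0 :: bit)"
  obtain e where e: "g ?o = bit_sign e"
  proof -
    have "g ?o = bit_sign 0 \<or> g ?o = bit_sign 1"
      using pm[of ?o] by (auto simp: bit_sign_def)
    thus ?thesis using that by blast
  qed
  have "g u = bit_sign (u ! s + e)" if "length u = r" for u
    using length_replicate[of r "0::bit"] that
  proof (induction rule: cube_flip_induct)
    case base
    show ?case using e s by simp
  next
    case (step w i)
    show ?case
    proof (cases "i = s")
      case True
      have flipped: "flip s w ! s = w ! s + 1" using step s by (simp add: nth_flip)
      have "g (flip s w) = - g w"
        using all[of w] pm[of w] pm[of "flip s w"] step by auto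
      also have "g w = bit_sign (w ! s + e)" by (rule step)
      also have "- bit_sign (w ! s + e) = bit_sign (flip s w ! s + e)"
        unfolding flipped bit_sign_add[of _ e] bit_sign_add_1 by simp
      finally show ?thesis by (simp only: True)
    next
      case False
      hence "g (flip i w) = g w"
        using sparse[of w i s] step all[of w] s by blast
      thus ?thesis using step False by (simp add: nth_flip)
    qed
  qed
  thus ?thesis using s by blast
qed

lemma laplacian_bit_sign:
  assumes u: "length u = r" and s: "s < r"
  shows "laplacian (hypercube r) (\<lambda>v. bit_sign (v ! s)) u = -2 * bit_sign (u ! s)"
proof -
  have "laplacian (hypercube r) (\<lambda>v. bit_sign (v ! s)) u =
      (\<Sum>i<r. if i = s then -2 * bit_sign (u ! s) else 0)"
    unfolding laplacian_hypercube[OF u]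
    by (rule sum.cong) (use u in \<open>auto simp: nth_flip bit_sign_def\<close>)
  thus ?thesis using s by simp
qed

section \<open>Automorphisms of the hypercube\<close>

definition signed_permutation ::
  "nat \<Rightarrow> (nat \<Rightarrow> nat) \<Rightarrow> (nat \<Rightarrow> bit) \<Rightarrow> bit list \<Rightarrow> bit list" where
  "signed_permutation r p e u = map (\<lambda>j. u ! p j + e j) [0..<r]"

lemma graph_isomorphism_signed_permutation:
  assumes p: "bij_betw p {..<r} {..<r}"
  shows "graph_isomorphism (hypercube r) (hypercube r) (signed_permutation r p e)"
proof -
  let ?h = "signed_permutation r p e"
  have len: "length (?h u) = r" for u by (simp add: signed_permutation_def)
  have nth: "?h u ! j = u ! p j + e j" if "j < r" for u j
    using that by (simp add: signed_permutation_def)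
  have plt: "p j < r" if "j < r" for j using bij_betwE[OF p] that by auto
  have pinv: "\<exists>j<r. p j = i" if "i < r" for i
    using p that by (metis bij_betw_def imageE lessThan_iff)
  have "inj_on ?h {u. length u = r}"
  proof (rule inj_onI)
    fix u v assume uv: "u \<in> {u. length u = r}" "v \<in> {u. length u = r}" and eq: "?h u = ?h v"
    have "u ! i = v ! i" if i: "i < r" for i
    proof -
      obtain j where "j < r" "p j = i" using pinv[OF i] by blast
      thus ?thesis using arg_cong[OF eq, of "\<lambda>l. l ! j"] by (simp only: nth add_right_cancel)
    qed
    thus "u = v" using uv by (intro nth_equalityI) auto
  qed
  moreover have "?h ` {u. length u = r} \<subseteq> {u. length u = r}" using len by auto
  ultimately have "bij_betw ?h {u. length u = r} {u. length u = r}"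
    using endo_inj_surj[OF finite_bit_lists] unfolding bij_betw_def by blast
  moreover have "(?h u, ?h v) \<in> parcs (hypercube r) \<longleftrightarrow> (u, v) \<in> parcs (hypercube r)"
    if uv: "length u = r" "length v = r" for u v
  proof -
    have flip: "flip j (?h u) = ?h (flip (p j) u)" if j: "j < r" for j
    proof (rule nth_equalityI)
      fix i assume "i < length (flip j (?h u))"
      hence i: "i < r" by (simp add: len)
      have pp: "p j = p i \<longleftrightarrow> j = i"
        using inj_on_eq_iff[OF bij_betw_imp_inj_on[OF p], of j i] i j by simp
      have "flip j (?h u) ! i = (if j = i then u ! p i + e i + 1 else u ! p i + e i)"
        using nth_flip[of j "?h u" i] j by (simp only: len nth[OF i])
      moreover have "?h (flip (p j) u) ! i = (if j = i then u ! p i + 1 else u ! p i) + e i"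
        using nth_flip[of "p j" u "p i"] plt[OF j] uv by (simp only: nth[OF i] pp)
      ultimately show "flip j (?h u) ! i = ?h (flip (p j) u) ! i"
        by (cases "j = i") (simp_all only: refl if_True if_False ac_simps)
    qed (simp add: len)
    have "(?h u, ?h v) \<in> parcs (hypercube r) \<longleftrightarrow> (\<exists>j<r. ?h v = ?h (flip (p j) u))"
      using flip by (auto simp: hypercube_arc_iff len)
    also have "\<dots> \<longleftrightarrow> (\<exists>j<r. v = flip (p j) u)"
      using inj_on_eq_iff[OF \<open>inj_on ?h _\<close>] uv by auto
    also have "\<dots> \<longleftrightarrow> (\<exists>i<r. v = flip i u)"
      using plt pinv by metis
    finally show ?thesis using uv by (simp add: hypercube_arc_iff)
  qed
  ultimately show ?thesis by (simp add: graph_isomorphism_def pverts_hypercube)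
qed

text \<open>
  An assignment of coordinates to the last positions alone determines no automorphism of the cube;
  the positions below \<open>k\<close> receive the unused coordinates in an arbitrary order.
\<close>
lemma extend_injection_to_permutation:
  fixes q :: "nat \<Rightarrow> nat"
  assumes inj: "inj_on q {k..<r}" and sub: "q ` {k..<r} \<subseteq> {..<r}" and "k \<le> r"
  shows "\<exists>p. bij_betw p {..<r} {..<r} \<and> (\<forall>j\<in>{k..<r}. p j = q j)"
proof -
  have "card {..<k} = card ({..<r} - q ` {k..<r})"
    using card_Diff_subset[of "q ` {k..<r}" "{..<r}"] sub card_image[OF inj] \<open>k \<le> r\<close> by simp
  then obtain h where h: "bij_betw h {..<k} ({..<r} - q ` {k..<r})"
    using finite_same_card_bij by blast
  define p where "p j = (if j < k then h j else q j)" for j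
  have "bij_betw p ({..<k} \<union> {k..<r}) (({..<r} - q ` {k..<r}) \<union> q ` {k..<r})"
  proof (rule bij_betw_combine)
    show "bij_betw p {..<k} ({..<r} - q ` {k..<r})"
      using h bij_betw_cong[of "{..<k}" p h] by (simp add: p_def)
    have "bij_betw q {k..<r} (q ` {k..<r})" using inj by (simp add: bij_betw_def)
    thus "bij_betw p {k..<r} (q ` {k..<r})"
      using bij_betw_cong[of "{k..<r}" p q] by (simp add: p_def)
  qed blast
  moreover have "{..<k} \<union> {k..<r} = {..<r}" using \<open>k \<le> r\<close> by auto
  moreover have "({..<r} - q ` {k..<r}) \<union> q ` {k..<r} = {..<r}" using sub by auto
  ultimately have "bij_betw p {..<r} {..<r}" by simp
  thus ?thesis by (intro exI[of _ p]) (auto simp: p_def)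
qed

text \<open>
  Two neighbours that differ in one of the last \<open>m\<close> coordinates have images that differ there as
  well. The images are adjacent too, so they agree in the first \<open>k\<close> coordinates. By connectedness of
  the factor \<open>H\<^sub>m\<close>, the first \<open>k\<close> coordinates of the image do not depend on the last \<open>m\<close>
  coordinates, which may therefore be set to zero.
\<close>
lemma automorphism_fixing_last_coordinates:
  assumes iso: "graph_isomorphism (hypercube (k + m)) (hypercube (k + m)) \<tau>"
    and fix_last: "\<And>z. length z = k + m \<Longrightarrow> drop k (\<tau> z) = drop k z"
    and z: "length z = k + m"
  shows "\<tau> z = take k (\<tau> (take k z @ replicate m 0)) @ drop k z"
proof -
  let ?v = "take k z"
  have len: "length (\<tau> y) = k + m" if "length y = k + m" for y
    using iso that by (auto simp: graph_isomorphism_def pverts_hypercube dest: bij_betwE)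
  have "take k (\<tau> (?v @ w)) = take k (\<tau> (?v @ replicate m 0))" if "length w = m" for w
    using length_replicate[of m "0::bit"] that
  proof (induction rule: cube_flip_induct)
    case base
    show ?case ..
  next
    case (step w i)
    let ?y = "?v @ w" and ?y' = "?v @ flip i w"
    have l: "length ?y = k + m" "length ?y' = k + m" using step z by simp_all
    have dr: "drop k (\<tau> ?y) = w" "drop k (\<tau> ?y') = flip i w"
      using fix_last[OF l(1)] fix_last[OF l(2)] z by simp_all
    have "(?y, ?y') \<in> parcs (hypercube (k + m))"
      using step z by (subst hypercube_append_adj) (auto simp: hypercube_arc_iff)
    hence "(\<tau> ?y, \<tau> ?y') \<in> parcs (hypercube (k + m))"
      using iso l by (simp add: graph_isomorphism_def pverts_hypercube)
    hence "(take k (\<tau> ?y) @ w, take k (\<tau> ?y') @ flip i w) \<in> parcs (hypercube (k + m))"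
      by (metis append_take_drop_id dr)
    hence "take k (\<tau> ?y) = take k (\<tau> ?y')"
      using step(1,2) len[OF l(1)] len[OF l(2)] flip_neq[of i w]
      by (subst (asm) hypercube_append_adj) auto
    thus ?case using step by simp
  qed
  from this[of "drop k z"] show ?thesis
    using z fix_last[OF z] by (metis add_diff_cancel_left' append_take_drop_id length_drop)
qed

section \<open>Graph bundles and changes of fibre coordinates\<close>

lemma graph_isomorphism_in_verts:
  "graph_isomorphism G H h \<Longrightarrow> x \<in> pverts G \<Longrightarrow> h x \<in> pverts H"
  by (auto simp: graph_isomorphism_def dest: bij_betwE)

lemma graph_isomorphism_comp:
  assumes "graph_isomorphism G H h" "graph_isomorphism H K k"
  shows "graph_isomorphism G K (k \<circ> h)"
  using assms graph_isomorphism_in_verts[OF assms(1)]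
  by (auto simp: graph_isomorphism_def intro: bij_betw_trans)

lemma graph_isomorphism_inv_into:
  assumes "graph_isomorphism G H h"
  shows "graph_isomorphism H G (inv_into (pverts G) h)"
proof -
  let ?i = "inv_into (pverts G) h"
  have bij: "bij_betw h (pverts G) (pverts H)"
    and arcs: "\<And>x y. x \<in> pverts G \<Longrightarrow> y \<in> pverts G \<Longrightarrow> (h x, h y) \<in> parcs H \<longleftrightarrow> (x, y) \<in> parcs G"
    using assms by (auto simp: graph_isomorphism_def)
  have i: "?i u \<in> pverts G" "h (?i u) = u" if "u \<in> pverts H" for u
    using that bij by (auto simp: bij_betw_def f_inv_into_f inv_into_into)
  have "(?i u, ?i v) \<in> parcs G \<longleftrightarrow> (u, v) \<in> parcs H" if "u \<in> pverts H" "v \<in> pverts H" for u v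
    using arcs[of "?i u" "?i v"] i that by simp
  thus ?thesis using bij_betw_inv_into[OF bij] by (simp add: graph_isomorphism_def)
qed

lemma transition_mapsD:
  assumes "transition_maps G F \<sigma>" "(x, y) \<in> parcs G"
  shows "graph_isomorphism F F (\<sigma> x y)"
    and "u \<in> pverts F \<Longrightarrow> \<sigma> y x (\<sigma> x y u) = u"
    and "u \<in> pverts F \<Longrightarrow> \<sigma> x y u \<in> pverts F"
  using assms graph_isomorphism_in_verts[of F F "\<sigma> x y" u] by (auto simp: transition_maps_def)

lemma pverts_graph_bundle: "pverts (graph_bundle G \<sigma> F) = pverts G \<times> pverts F"
  by (simp add: graph_bundle_def)

lemma graph_bundle_arc_iff:
  assumes "x \<in> pverts G" "u \<in> pverts F"
  shows "((x, u), (y, v)) \<in> parcs (graph_bundle G \<sigma> F) \<longleftrightarrow>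
    (x, y) \<in> parcs G \<and> v = \<sigma> x y u \<or> x = y \<and> (u, v) \<in> parcs F"
  using assms by (auto simp: graph_bundle_def)

lemma graph_bundle_head_in_verts:
  assumes "pair_graph G" "pair_graph F" "transition_maps G F \<sigma>"
    and "(p, q) \<in> parcs (graph_bundle G \<sigma> F)"
  shows "q \<in> pverts (graph_bundle G \<sigma> F)"
proof -
  interpret G: pair_graph G by fact
  interpret F: pair_graph F by fact
  show ?thesis
    using assms(4) transition_mapsD(3)[OF assms(3)]
    by (auto simp: graph_bundle_def dest: G.in_arcsD1 G.in_arcsD2 F.in_arcsD1 F.in_arcsD2)
qed

text \<open>
  The family \<open>\<phi>\<close> of fibre automorphisms is a change of trivialization: the new transition maps are
  \<open>\<phi>\<^sub>y \<circ> \<sigma>\<^sub>x\<^sub>y \<circ> \<phi>\<^sub>x\<^sup>-\<^sup>1\<close>.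
\<close>
lemma transition_maps_change_of_coordinates:
  assumes "pair_graph G" and \<sigma>: "transition_maps G F \<sigma>"
    and \<phi>: "\<And>x. x \<in> pverts G \<Longrightarrow> graph_isomorphism F F (\<phi> x)"
  shows "transition_maps G F (\<lambda>x y. \<phi> y \<circ> \<sigma> x y \<circ> inv_into (pverts F) (\<phi> x))"
    (is "transition_maps G F ?\<tau>")
proof -
  interpret pair_graph G by fact
  have inv: "inv_into (pverts F) (\<phi> x) u \<in> pverts F" "\<phi> x (inv_into (pverts F) (\<phi> x) u) = u"
    "inv_into (pverts F) (\<phi> x) (\<phi> x u) = u"
    if "x \<in> pverts G" "u \<in> pverts F" for x u
    using \<phi>[OF that(1)] that(2)
    by (auto simp: graph_isomorphism_def bij_betw_def inv_into_into f_inv_into_f inv_into_f_f)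
  have "graph_isomorphism F F (?\<tau> x y)" if "(x, y) \<in> parcs G" for x y
    using that by (intro graph_isomorphism_comp[of _ F] graph_isomorphism_inv_into \<phi>
        transition_mapsD(1)[OF \<sigma>]) (auto dest: in_arcsD1 in_arcsD2)
  moreover have "?\<tau> y x (?\<tau> x y u) = u" if "(x, y) \<in> parcs G" "u \<in> pverts F" for x y u
    using that in_arcsD1[OF that(1)] in_arcsD2[OF that(1)]
    by (simp add: inv transition_mapsD[OF \<sigma>])
  ultimately show ?thesis by (auto simp: transition_maps_def)
qed

lemma bundle_isomorphic_change_of_coordinates:
  assumes "pair_graph G" "pair_graph F" and \<sigma>: "transition_maps G F \<sigma>"
    and \<phi>: "\<And>x. x \<in> pverts G \<Longrightarrow> graph_isomorphism F F (\<phi> x)"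
    and \<tau>: "\<And>x y u. (x, y) \<in> parcs G \<Longrightarrow> u \<in> pverts F \<Longrightarrow> \<tau> x y (\<phi> x u) = \<phi> y (\<sigma> x y u)"
  shows "bundle_isomorphic (graph_bundle G \<sigma> F) (graph_bundle G \<tau> F)"
proof -
  interpret G: pair_graph G by fact
  define \<Psi> where "\<Psi> = (\<lambda>(x, u). (x, \<phi> x u))"
  have bij: "bij_betw (\<phi> x) (pverts F) (pverts F)" if "x \<in> pverts G" for x
    using \<phi>[OF that] by (simp add: graph_isomorphism_def)
  have inj: "\<phi> x u = \<phi> x v \<longleftrightarrow> u = v" if "x \<in> pverts G" "u \<in> pverts F" "v \<in> pverts F" for x u v
    using bij[OF that(1)] that by (auto simp: bij_betw_def inj_on_eq_iff)
  have "inj_on \<Psi> (pverts G \<times> pverts F)"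
    by (auto simp: \<Psi>_def inj_on_def inj)
  moreover have "\<Psi> ` (pverts G \<times> pverts F) = pverts G \<times> pverts F"
  proof
    show "\<Psi> ` (pverts G \<times> pverts F) \<subseteq> pverts G \<times> pverts F"
      using bij by (auto simp: \<Psi>_def dest: bij_betwE)
    show "pverts G \<times> pverts F \<subseteq> \<Psi> ` (pverts G \<times> pverts F)"
    proof clarify
      fix x u assume x: "x \<in> pverts G" and "u \<in> pverts F"
      then obtain v where "v \<in> pverts F" "u = \<phi> x v"
        using bij[OF x] unfolding bij_betw_def by blast
      thus "(x, u) \<in> \<Psi> ` (pverts G \<times> pverts F)" using x by (auto simp: \<Psi>_def)
    qed
  qed
  moreover have "(\<Psi> (x, u), \<Psi> (y, v)) \<in> parcs (graph_bundle G \<tau> F) \<longleftrightarrow>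
      ((x, u), (y, v)) \<in> parcs (graph_bundle G \<sigma> F)"
    if *: "x \<in> pverts G" "u \<in> pverts F" "y \<in> pverts G" "v \<in> pverts F" for x u y v
  proof -
    have \<phi>u: "\<phi> x u \<in> pverts F" using graph_isomorphism_in_verts[OF \<phi>] * by blast
    have "(\<phi> x u, \<phi> x v) \<in> parcs F \<longleftrightarrow> (u, v) \<in> parcs F"
      using \<phi>[OF *(1)] * by (simp add: graph_isomorphism_def)
    moreover have "\<phi> y v = \<tau> x y (\<phi> x u) \<longleftrightarrow> v = \<sigma> x y u" if "(x, y) \<in> parcs G"
      using \<tau>[OF that *(2)] inj[OF *(3,4) transition_mapsD(3)[OF \<sigma> that *(2)]] by simp
    ultimately show ?thesis
      using * \<phi>u by (auto simp: \<Psi>_def graph_bundle_arc_iff)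
  qed
  ultimately have "graph_isomorphism (graph_bundle G \<sigma> F) (graph_bundle G \<tau> F) \<Psi>"
    by (auto simp: graph_isomorphism_def pverts_graph_bundle bij_betw_def)
  thus ?thesis unfolding bundle_isomorphic_def
    by (intro exI[of _ \<Psi>]) (auto simp: \<Psi>_def pverts_graph_bundle)
qed

lemma restrict_transition_maps:
  assumes "pair_graph G" and \<tau>: "transition_maps G (hypercube (k + m)) \<tau>"
    and fix_last: "\<And>x y z. (x, y) \<in> parcs G \<Longrightarrow> length z = k + m \<Longrightarrow> drop k (\<tau> x y z) = drop k z"
  obtains \<rho> where "transition_maps G (hypercube k) \<rho>"
    and "\<And>x y z. (x, y) \<in> parcs G \<Longrightarrow> length z = k + m \<Longrightarrow> extend_transition k \<rho> x y z = \<tau> x y z"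
proof -
  interpret pair_graph G by fact
  define \<rho> where "\<rho> x y v = take k (\<tau> x y (v @ replicate m 0))" for x y and v :: "bit list"
  have split: "\<tau> x y z = \<rho> x y (take k z) @ drop k z"
    if "(x, y) \<in> parcs G" "length z = k + m" for x y z
    unfolding \<rho>_def using that
    by (intro automorphism_fixing_last_coordinates fix_last transition_mapsD(1)[OF \<tau>])
  have len: "length (\<rho> x y v) = k" if "(x, y) \<in> parcs G" "length v = k" for x y v
    using transition_mapsD(3)[OF \<tau> that(1), of "v @ replicate m 0"] that
    by (simp add: \<rho>_def pverts_hypercube)
  have cancel: "\<rho> y x (\<rho> x y v) = v" if xy: "(x, y) \<in> parcs G" and v: "length v = k" for x y v
  proof -
    let ?z = "v @ replicate m 0"
    have z: "length ?z = k + m" using v by simp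
    have yx: "(y, x) \<in> parcs G" using pair_sym_arcs xy by (auto simp: symmetric_def dest: symD)
    have "\<tau> x y ?z = \<rho> x y v @ replicate m 0" using split[OF xy z] v by simp
    moreover have "\<tau> y x (\<rho> x y v @ replicate m 0) = \<rho> y x (\<rho> x y v) @ replicate m 0"
      using split[OF yx, of "\<rho> x y v @ replicate m 0"] len[OF xy v] by simp
    moreover have "\<tau> y x (\<tau> x y ?z) = ?z"
      using transition_mapsD(2)[OF \<tau> xy, of ?z] z by (simp add: pverts_hypercube)
    ultimately show ?thesis by simp
  qed
  have iso: "graph_isomorphism (hypercube k) (hypercube k) (\<rho> x y)" if xy: "(x, y) \<in> parcs G" for x y
  proof -
    have yx: "(y, x) \<in> parcs G" using pair_sym_arcs xy by (auto simp: symmetric_def dest: symD)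
    have "bij_betw (\<rho> x y) {v. length v = k} {v. length v = k}"
      by (rule bij_betw_byWitness[where f' = "\<rho> y x"]) (use cancel len xy yx in auto)
    moreover have "(\<rho> x y u, \<rho> x y v) \<in> parcs (hypercube k) \<longleftrightarrow> (u, v) \<in> parcs (hypercube k)"
      if uv: "length u = k" "length v = k" for u v
    proof -
      let ?o = "replicate m (0 :: bit)"
      have z: "length (u @ ?o) = k + m" "length (v @ ?o) = k + m" using uv by auto
      have "(\<tau> x y (u @ ?o), \<tau> x y (v @ ?o)) \<in> parcs (hypercube (k + m)) \<longleftrightarrow>
          (u @ ?o, v @ ?o) \<in> parcs (hypercube (k + m))"
        using transition_mapsD(1)[OF \<tau> xy] z by (simp add: graph_isomorphism_def pverts_hypercube)
      moreover have "(a @ ?o, b @ ?o) \<in> parcs (hypercube (k + m)) \<longleftrightarrow> (a, b) \<in> parcs (hypercube k)"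
        if "length a = k" "length b = k" for a b
        using that by (subst hypercube_append_adj) (auto simp: hypercube_def)
      ultimately show ?thesis
        using split[OF xy z(1)] split[OF xy z(2)] uv len[OF xy] by simp
    qed
    ultimately show ?thesis by (simp add: graph_isomorphism_def pverts_hypercube)
  qed
  show thesis
  proof (rule that[of \<rho>])
    show "transition_maps G (hypercube k) \<rho>"
      using iso cancel by (auto simp: transition_maps_def pverts_hypercube)
  qed (simp add: extend_transition_def split)
qed

text \<open>
  Connectedness is stated for the symmetric closure of the arcs, which adds no arcs to a
  \<^const>\<open>pair_graph\<close>, so \<open>step\<close> is needed for the given arcs only.
\<close>
lemma connected_vertex_induct:
  assumes "pair_graph G" "Digraph_Component.connected (with_proj G)"
    and "x \<in> pverts G" "y \<in> pverts G" "P x"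
    and step: "\<And>a b. (a, b) \<in> parcs G \<Longrightarrow> P a \<Longrightarrow> P b"
  shows "P y"
proof -
  interpret pair_graph G by fact
  have arcs: "parcs (mk_symmetric (with_proj G)) \<subseteq> parcs G"
    using pair_sym_arcs by (auto simp: mk_symmetric_def symmetric_def dest: symD)
  have "x \<rightarrow>\<^sup>*\<^bsub>with_proj (mk_symmetric (with_proj G))\<^esub> y"
    using assms(2-4) by (auto simp: connected_def strongly_connected_def mk_symmetric_def)
  hence "(x, y) \<in> rtrancl_on (pverts (mk_symmetric (with_proj G))) (parcs (mk_symmetric (with_proj G)))"
    by (simp add: reachable_def)
  thus ?thesis
    by (induction rule: rtrancl_on_induct) (use assms(5) step arcs in auto)
qed

section \<open>The Laplacian of a bundle\<close>

lemma laplacian_graph_bundle: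
  assumes "pair_graph G" "pair_graph F" and xu: "x \<in> pverts G" "u \<in> pverts F"
  shows "laplacian (graph_bundle G \<sigma> F) f (x, u) =
    (\<Sum>y\<in>{y. (x, y) \<in> parcs G}. f (y, \<sigma> x y u) - f (x, u)) + laplacian F (\<lambda>v. f (x, v)) u"
proof -
  interpret G: pair_graph G by fact
  interpret F: pair_graph F by fact
  let ?N = "{y. (x, y) \<in> parcs G}" and ?M = "{v. (u, v) \<in> parcs F}"
  have fin: "finite ?N" "finite ?M"
    using finite_subset[OF _ G.pair_finite_verts, of ?N] finite_subset[OF _ F.pair_finite_verts, of ?M]
    by (auto dest: G.in_arcsD2 F.in_arcsD2)
  have nb: "{q. ((x, u), q) \<in> parcs (graph_bundle G \<sigma> F)} =
      (\<lambda>y. (y, \<sigma> x y u)) ` ?N \<union> Pair x ` ?M"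
    using xu by (auto simp: graph_bundle_arc_iff)
  have disj: "(\<lambda>y. (y, \<sigma> x y u)) ` ?N \<inter> Pair x ` ?M = {}"
    using G.pair_no_loops by fastforce
  have "laplacian (graph_bundle G \<sigma> F) f (x, u) =
      (\<Sum>q\<in>(\<lambda>y. (y, \<sigma> x y u)) ` ?N. f q - f (x, u)) + (\<Sum>q\<in>Pair x ` ?M. f q - f (x, u))"
    unfolding laplacian_def nb using fin disj by (intro sum.union_disjoint) auto
  thus ?thesis
    by (simp add: laplacian_def sum.reindex inj_on_def)
qed

lemma sum_laplacian_eq_0:
  assumes "pair_graph F"
  shows "(\<Sum>u\<in>pverts F. laplacian F g u) = 0"
proof -
  interpret pair_graph F by fact
  have sym: "(v, u) \<in> parcs F \<longleftrightarrow> (u, v) \<in> parcs F" for u v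
    using pair_sym_arcs by (auto simp: symmetric_def dest: symD)
  have fin: "finite {v. (u, v) \<in> parcs F}" for u
    by (rule finite_subset[OF _ pair_finite_verts]) (auto dest: in_arcsD2)
  have *: "(\<Sum>u\<in>pverts F. \<Sum>v\<in>{v. (u, v) \<in> parcs F}. h u v) = (\<Sum>(u, v)\<in>parcs F. h u v)"
    for h :: "_ \<Rightarrow> _ \<Rightarrow> real"
  proof -
    have "Sigma (pverts F) (\<lambda>u. {v. (u, v) \<in> parcs F}) = parcs F" by (auto dest: in_arcsD1)
    thus ?thesis using sum.Sigma[of "pverts F" "\<lambda>u. {v. (u, v) \<in> parcs F}" h]
        pair_finite_verts fin by simp
  qed
  have "(\<Sum>(u, v)\<in>parcs F. g v - g u) = (\<Sum>(u, v)\<in>parcs F. g u - g v)"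
    by (rule sum.reindex_bij_witness[of _ prod.swap prod.swap]) (auto simp: sym)
  also have "\<dots> = - (\<Sum>(u, v)\<in>parcs F. g v - g u)"
    unfolding sum_negf[symmetric] by (rule sum.cong) auto
  finally show ?thesis unfolding laplacian_def * by simp
qed

text \<open>
  The fibre sums of an eigenvector satisfy the eigenvalue equation on the base: the fibre part of the
  Laplacian cancels in the sum, and the transition maps only permute the terms of the horizontal
  part. A nonzero eigenvalue below the gap leaves only the zero function.
\<close>
lemma fibre_sums_eq_0:
  assumes "pair_graph G" "pair_graph F" and \<sigma>: "transition_maps G F \<sigma>"
    and gap: "ereal l < lambda1 G" "l \<noteq> 0"
    and f: "eigenvector (graph_bundle G \<sigma> F) l f"
    and x: "x \<in> pverts G"
  shows "(\<Sum>u\<in>pverts F. f (x, u)) = 0"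
proof (rule ccontr)
  assume nz: "(\<Sum>u\<in>pverts F. f (x, u)) \<noteq> 0"
  interpret G: pair_graph G by fact
  define S where "S x = (\<Sum>u\<in>pverts F. f (x, u))" for x
  have "laplacian G S y = - l * S y" if y: "y \<in> pverts G" for y
  proof -
    have reindex: "(\<Sum>u\<in>pverts F. f (z, \<sigma> y z u)) = S z" if "(y, z) \<in> parcs G" for z
      unfolding S_def using transition_mapsD(1)[OF \<sigma> that]
      by (intro sum.reindex_bij_betw) (simp add: graph_isomorphism_def)
    have "- l * S y = (\<Sum>u\<in>pverts F. laplacian (graph_bundle G \<sigma> F) f (y, u))"
      unfolding S_def sum_distrib_left
      using f y by (intro sum.cong) (auto simp: eigenvector_def pverts_graph_bundle)
    also have "\<dots> = (\<Sum>u\<in>pverts F. \<Sum>z\<in>{z. (y, z) \<in> parcs G}. f (z, \<sigma> y z u) - f (y, u))"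
      using sum_laplacian_eq_0[OF assms(2)] y
      by (simp add: laplacian_graph_bundle[OF assms(1,2)] sum.distrib)
    also have "\<dots> = (\<Sum>z\<in>{z. (y, z) \<in> parcs G}. \<Sum>u\<in>pverts F. f (z, \<sigma> y z u) - f (y, u))"
      by (rule sum.swap)
    also have "\<dots> = (\<Sum>z\<in>{z. (y, z) \<in> parcs G}. S z - S y)"
      by (rule sum.cong) (auto simp: sum_subtractf reindex S_def[symmetric])
    finally show ?thesis by (simp add: laplacian_def)
  qed
  hence "eigenvector G l S" using nz x by (auto simp: eigenvector_def S_def)
  hence "lambda1 G \<le> ereal l" unfolding lambda1_def using gap(2) by (intro INF_lower) auto
  thus False using gap(1) by simp
qed

lemma laplacian_graph_isomorphism:
  assumes iso: "graph_isomorphism G H h" and p: "p \<in> pverts G"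
    and "\<And>q. (p, q) \<in> parcs G \<Longrightarrow> q \<in> pverts G" "\<And>q. (h p, q) \<in> parcs H \<Longrightarrow> q \<in> pverts H"
  shows "laplacian G (f \<circ> h) p = laplacian H f (h p)"
proof -
  have bij: "bij_betw h (pverts G) (pverts H)" using iso by (simp add: graph_isomorphism_def)
  have "h ` {q. (p, q) \<in> parcs G} = {q. (h p, q) \<in> parcs H}"
  proof
    show "h ` {q. (p, q) \<in> parcs G} \<subseteq> {q. (h p, q) \<in> parcs H}"
      using iso p assms(3) by (auto simp: graph_isomorphism_def)
    show "{q. (h p, q) \<in> parcs H} \<subseteq> h ` {q. (p, q) \<in> parcs G}"
    proof clarify
      fix q assume q: "(h p, q) \<in> parcs H"
      then obtain q' where "q' \<in> pverts G" "q = h q'"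
        using assms(4) bij unfolding bij_betw_def by blast
      thus "q \<in> h ` {q. (p, q) \<in> parcs G}"
        using iso p q by (auto simp: graph_isomorphism_def)
    qed
  qed
  moreover have "inj_on h {q. (p, q) \<in> parcs G}"
    using bij assms(3) by (auto simp: bij_betw_def intro: inj_on_subset)
  ultimately have "bij_betw h {q. (p, q) \<in> parcs G} {q. (h p, q) \<in> parcs H}"
    by (simp add: bij_betw_def)
  from sum.reindex_bij_betw[OF this, of "\<lambda>q. f q - f (h p)"] show ?thesis
    by (simp add: laplacian_def)
qed

section \<open>Two-valued eigenvectors of cube bundles\<close>

lemma sum_le_sum_subset_if_nonpos:
  fixes h :: "'b \<Rightarrow> real"
  assumes "finite B" "A \<subseteq> B" "\<And>b. b \<in> B - A \<Longrightarrow> h b \<le> 0"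
  shows "sum h B \<le> sum h A"
  using sum_mono2[of B A "\<lambda>b. - h b"] assms by (simp add: sum_negf)

text \<open>
  Multiplied by \<open>f (x, u)\<close>, every term of the Laplacian at \<open>(x, u)\<close> is \<open>0\<close> or \<open>-2\<close>, and the terms
  add up to \<open>-2\<close>. Two sign changes in the fibre would exceed this total, and the one sign change
  that each vertex does have in its fibre uses it up and leaves none for the horizontal edges.
\<close>
lemma pm_eigenvector_rigidity:
  assumes "pair_graph G" and \<sigma>: "transition_maps G (hypercube r) \<sigma>"
    and gap: "lambda1 G > 2"
    and ev: "eigenvector (graph_bundle G \<sigma> (hypercube r)) 2 f"
    and pm: "f ` pverts (graph_bundle G \<sigma> (hypercube r)) \<subseteq> {-1, 1}"
    and x: "x \<in> pverts G"
  shows pm_eigenvector_signed_coordinate: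
      "\<exists>s<r. \<exists>e. \<forall>u. length u = r \<longrightarrow> f (x, u) = bit_sign (u ! s + e)"
    and pm_eigenvector_horizontally_constant:
      "(x, y) \<in> parcs G \<Longrightarrow> length u = r \<Longrightarrow> f (y, \<sigma> x y u) = f (x, u)"
proof -
  interpret G: pair_graph G by fact
  note H = pair_graph_hypercube[of r]
  have val: "f (z, u) = -1 \<or> f (z, u) = 1" if "z \<in> pverts G" "length u = r" for z u
    using pm that by (auto simp: pverts_graph_bundle pverts_hypercube)
  have \<sigma>_len: "length (\<sigma> x y u) = r" if "(x, y) \<in> parcs G" "length u = r" for y u
    using transition_mapsD(3)[OF \<sigma> that(1)] that(2) by (simp add: pverts_hypercube)
  define hor where "hor u y = f (x, u) * (f (y, \<sigma> x y u) - f (x, u))" for u y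
  define ver where "ver u i = f (x, u) * (f (x, flip i u) - f (x, u))" for u i
  let ?N = "{y. (x, y) \<in> parcs G}"
  have finN: "finite ?N"
    using finite_subset[OF _ G.pair_finite_verts, of ?N] by (auto dest: G.in_arcsD2)
  have hor_le: "hor u y \<le> 0" if "length u = r" "y \<in> ?N" for u y
    using val[OF x that(1)] val[of y "\<sigma> x y u"] \<sigma>_len that G.in_arcsD2[of x y]
    by (auto simp: hor_def)
  have ver_le: "ver u i \<le> 0" if "length u = r" for u i
    using val[OF x that] val[OF x, of "flip i u"] that by (auto simp: ver_def)
  have ver_change: "ver u i = -2" if "length u = r" "f (x, flip i u) \<noteq> f (x, u)" for u i
    using val[OF x that(1)] val[OF x, of "flip i u"] that by (auto simp: ver_def)
  have total: "(\<Sum>y\<in>?N. hor u y) + (\<Sum>i<r. ver u i) = -2" if u: "length u = r" for u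
  proof -
    have "f (x, u) * laplacian (graph_bundle G \<sigma> (hypercube r)) f (x, u) =
        (\<Sum>y\<in>?N. hor u y) + (\<Sum>i<r. ver u i)"
      using x u by (simp add: laplacian_graph_bundle[OF assms(1) H] pverts_hypercube
          laplacian_hypercube hor_def ver_def distrib_left sum_distrib_left)
    moreover have "laplacian (graph_bundle G \<sigma> (hypercube r)) f (x, u) = - 2 * f (x, u)"
      using ev x u by (auto simp: eigenvector_def pverts_graph_bundle pverts_hypercube)
    ultimately show ?thesis using val[OF x u] by auto
  qed
  have sparse: "i = j" if u: "length u = r" and ij: "i < r" "j < r"
    "f (x, flip i u) \<noteq> f (x, u)" "f (x, flip j u) \<noteq> f (x, u)" for u i j
  proof (rule ccontr)
    assume "i \<noteq> j"
    have "(\<Sum>i<r. ver u i) \<le> (\<Sum>i\<in>{i, j}. ver u i)"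
      by (rule sum_le_sum_subset_if_nonpos) (use ij ver_le[OF u] in auto)
    also have "\<dots> = -4" using \<open>i \<noteq> j\<close> ver_change[OF u] ij by simp
    finally show False using total[OF u] sum_nonpos[of ?N "hor u"] hor_le[OF u] by fastforce
  qed
  \<comment> \<open>The fibre sum vanishes, which a constant function with values \<open>1\<close> or \<open>-1\<close> does not allow.\<close>
  have "\<exists>a b. length a = r \<and> length b = r \<and> f (x, a) \<noteq> f (x, b)"
  proof (rule ccontr)
    let ?o = "replicate r (0 :: bit)"
    assume const: "\<not> ?thesis"
    have "f (x, u) = f (x, ?o)" if "u \<in> pverts (hypercube r)" for u
    proof (rule ccontr)
      assume "f (x, u) \<noteq> f (x, ?o)"
      moreover have "length u = r" using that by (simp only: pverts_hypercube mem_Collect_eq)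
      ultimately show False using length_replicate[of r "0 :: bit"] const by blast
    qed
    hence "(\<Sum>u\<in>pverts (hypercube r). f (x, u)) = (\<Sum>u\<in>pverts (hypercube r). f (x, ?o))"
      by (rule sum.cong[OF refl])
    also have "\<dots> = card {v :: bit list. length v = r} * f (x, ?o)"
      by (simp add: pverts_hypercube)
    finally have "real (card {v :: bit list. length v = r}) * f (x, ?o) = 0"
      using fibre_sums_eq_0[OF assms(1) H \<sigma> _ _ ev x] gap by simp
    moreover have "card {v :: bit list. length v = r} \<noteq> 0"
    proof
      assume "card {v :: bit list. length v = r} = 0"
      hence empty: "{v :: bit list. length v = r} = {}"
        by (simp only: card_0_eq[OF finite_bit_lists])
      have "?o \<in> {v. length v = r}" by simp
      thus False unfolding empty by (rule emptyE)
    qed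
    ultimately show False using val[OF x, of ?o] by auto
  qed
  then obtain a b where ab: "length a = r" "length b = r" "f (x, a) \<noteq> f (x, b)" by blast
  show coord: "\<exists>s<r. \<exists>e. \<forall>u. length u = r \<longrightarrow> f (x, u) = bit_sign (u ! s + e)"
    by (rule signed_coordinate_if_sparse_sign_changes[OF _ _ ab]) (use val[OF x] sparse in blast)+
  show "f (y, \<sigma> x y u) = f (x, u)" if xy: "(x, y) \<in> parcs G" and u: "length u = r"
  proof -
    obtain s e where s: "s < r" and fx: "\<And>v. length v = r \<Longrightarrow> f (x, v) = bit_sign (v ! s + e)"
      using coord by blast
    have "flip s u ! s \<noteq> u ! s"
      using s u bit_add_1_neq[of "u ! s"] by (simp add: nth_flip)
    hence "f (x, flip s u) \<noteq> f (x, u)"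
      using fx[OF u] fx[of "flip s u"] u by (simp only: length_flip bit_sign_eq_iff add_right_cancel not_False_eq_True)
    hence "ver u s = -2" using ver_change[OF u] by simp
    moreover have "(\<Sum>i<r. ver u i) \<le> (\<Sum>i\<in>{s}. ver u i)"
      by (rule sum_le_sum_subset_if_nonpos) (use s ver_le[OF u] in auto)
    moreover have "(\<Sum>z\<in>?N. hor u z) \<le> (\<Sum>z\<in>{y}. hor u z)"
      by (rule sum_le_sum_subset_if_nonpos) (use xy finN hor_le[OF u] in auto)
    ultimately have "hor u y \<ge> 0" using total[OF u] by simp
    thus ?thesis
      using val[OF x u] val[of y "\<sigma> x y u"] \<sigma>_len[OF xy u] G.in_arcsD2[OF xy]
      by (auto simp: hor_def)
  qed
qed

section \<open>Splitting off cube factors\<close>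

lemma bit_sign_self_add: "bit_sign a * bit_sign a = 1"
  by (simp add: bit_sign_def)

text \<open>
  In \<open>B \<box> H\<^sub>m\<close> the sign of a coordinate of \<open>H\<^sub>m\<close> changes along exactly one edge at each vertex,
  because the transition maps leave these coordinates alone. The isomorphism carries the signs
  to \<open>X\<close>.
\<close>
lemma eigenvectors_if_cube_factor:
  fixes G :: "'a pair_pre_digraph"
  assumes G: "pair_graph G" and "pverts G \<noteq> {}"
    and \<sigma>: "transition_maps G (hypercube (k + m)) \<sigma>"
    and \<rho>: "transition_maps G (hypercube k) \<rho>"
    and X: "X = graph_bundle G \<sigma> (hypercube (k + m))"
    and iso: "bundle_isomorphic X (as_cube_bundle (graph_bundle G \<rho> (hypercube k) \<box> hypercube m))"
  shows "\<exists>f :: nat \<Rightarrow> 'a \<times> bit list \<Rightarrow> real. lin_indep_on (pverts X) {1..m} f \<and>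
    (\<forall>i\<in>{1..m}. eigenvector X 2 (f i) \<and> f i ` pverts X \<subseteq> {-1, 1})"
proof -
  let ?H = "hypercube (k + m)"
  let ?\<tau> = "extend_transition k \<rho>"
  define Y where "Y = graph_bundle G ?\<tau> ?H"
  note H = pair_graph_hypercube[of "k + m"]
  have \<tau>: "transition_maps G ?H ?\<tau>" by (rule transition_maps_extend[OF G \<rho>])
  obtain \<Psi> where \<Psi>: "graph_isomorphism X Y \<Psi>"
    using iso unfolding as_cube_bundle_eq[OF \<rho>] bundle_isomorphic_def Y_def by blast
  have V: "pverts X = pverts G \<times> {z. length z = k + m}" "pverts Y = pverts G \<times> {z. length z = k + m}"
    by (simp_all add: X Y_def pverts_graph_bundle pverts_hypercube)
  have \<Psi>_image: "\<Psi> ` pverts X = pverts Y"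
    using \<Psi> by (simp add: graph_isomorphism_def bij_betw_def)
  define h where "h i = (\<lambda>(x :: 'a, z). bit_sign (z ! (k + i - 1)))" for i
  have lap: "laplacian Y (h i) q = -2 * h i q" if i: "i \<in> {1..m}" and q: "q \<in> pverts Y" for i q
  proof -
    obtain x z where xz: "q = (x, z)" "x \<in> pverts G" "length z = k + m"
      using q by (auto simp: V)
    have "?\<tau> x y z ! (k + i - 1) = z ! (k + i - 1)" if "(x, y) \<in> parcs G" for y
      using i xz transition_maps_hypercube_length[OF \<rho> that, of "take k z"]
      by (cases i) (simp_all add: extend_transition_def nth_append)
    hence "(\<Sum>y\<in>{y. (x, y) \<in> parcs G}. h i (y, ?\<tau> x y z) - h i (x, z)) = 0"
      by (simp add: h_def)
    moreover have "laplacian ?H (\<lambda>v. h i (x, v)) z = -2 * h i (x, z)"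
      unfolding h_def prod.case using i by (intro laplacian_bit_sign[OF xz(3)]) auto
    ultimately show ?thesis
      using laplacian_graph_bundle[OF G H xz(2), of z] xz by (simp add: Y_def pverts_hypercube)
  qed
  define f where "f i = h i \<circ> \<Psi>" for i
  have pm: "f i p \<in> {-1, 1}" for i p
    using bit_sign_pm1 by (auto simp: f_def h_def split: prod.split)
  have "eigenvector X 2 (f i)" if i: "i \<in> {1..m}" for i
  proof -
    have "laplacian X (f i) p = -2 * f i p" if p: "p \<in> pverts X" for p
    proof -
      have "laplacian X (f i) p = laplacian Y (h i) (\<Psi> p)"
        unfolding f_def using graph_bundle_head_in_verts[OF G H \<sigma>] graph_bundle_head_in_verts[OF G H \<tau>]
        by (intro laplacian_graph_isomorphism[OF \<Psi> p]) (auto simp: X Y_def)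
      moreover have "\<Psi> p \<in> pverts Y" using p \<Psi>_image by blast
      ultimately show ?thesis using lap[OF i] by (simp add: f_def)
    qed
    moreover obtain x where "x \<in> pverts G" using assms(2) by blast
    hence "(x, replicate (k + m) 0) \<in> pverts X" by (simp add: V)
    moreover have "f i p \<noteq> 0" for p using pm[of i p] by auto
    ultimately show ?thesis unfolding eigenvector_def by blast
  qed
  moreover have "lin_indep_on (pverts X) {1..m} f"
    unfolding lin_indep_on_def
  proof (intro allI impI ballI)
    fix c i assume c: "\<forall>p\<in>pverts X. (\<Sum>i\<in>{1..m}. c i * f i p) = 0" and i: "i \<in> {1..m}"
    have cY: "(\<Sum>i\<in>{1..m}. c i * h i q) = 0" if "q \<in> pverts Y" for q
    proof -
      obtain p where "p \<in> pverts X" "q = \<Psi> p" using \<Psi>_image \<open>q \<in> pverts Y\<close> by blast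
      thus ?thesis using c by (simp add: f_def)
    qed
    obtain x where x: "x \<in> pverts G" using assms(2) by blast
    let ?o = "replicate (k + m) (0 :: bit)" and ?s = "k + i - 1"
    \<comment> \<open>Moving across one edge in the direction of the \<open>i\<close>-th sign isolates its coefficient.\<close>
    have "0 = (\<Sum>j\<in>{1..m}. c j * h j (x, ?o)) - (\<Sum>j\<in>{1..m}. c j * h j (x, flip ?s ?o))"
      using cY x by (simp add: V)
    also have "\<dots> = (\<Sum>j\<in>{1..m}. if j = i then 2 * c i else 0)"
      unfolding sum_subtractf[symmetric]
    proof (rule sum.cong)
      fix j assume j: "j \<in> {1..m}"
      have idx: "?s = k + j - 1 \<longleftrightarrow> j = i" and lt: "k + j - 1 < k + m" "?s < k + m"
        using i j by auto
      have "flip ?s ?o ! (k + j - 1) = (if j = i then 1 else 0)"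
        using nth_flip[of ?s ?o "k + j - 1"] idx lt by simp
      thus "c j * h j (x, ?o) - c j * h j (x, flip ?s ?o) = (if j = i then 2 * c i else 0)"
        using lt(1) by (simp add: h_def bit_sign_def)
    qed simp
    finally show "c i = 0" using i by simp
  qed
  ultimately show ?thesis using pm by (intro exI[of _ f]) auto
qed

text \<open>
  By rigidity each eigenvector is a signed coordinate on each fibre. Fibre coordinates in which
  these are the last \<open>m\<close> coordinates make the last \<open>m\<close> coordinates horizontally constant, and this
  is what splits the transition maps.
\<close>
lemma cube_factor_if_eigenvectors:
  fixes G :: "'a pair_pre_digraph"
  assumes G: "pair_graph G" and conn: "Digraph_Component.connected (with_proj G)"
    and gap: "lambda1 G > 2"
    and \<sigma>: "transition_maps G (hypercube (k + m)) \<sigma>"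
    and X: "X = graph_bundle G \<sigma> (hypercube (k + m))"
    and indep: "lin_indep_on (pverts X) {1..m} f"
    and f: "\<And>i. i \<in> {1..m} \<Longrightarrow> eigenvector X 2 (f i) \<and> f i ` pverts X \<subseteq> {-1, 1}"
  shows "\<exists>\<rho>. transition_maps G (hypercube k) \<rho> \<and>
    bundle_isomorphic X (as_cube_bundle (graph_bundle G \<rho> (hypercube k) \<box> hypercube m))"
proof -
  interpret G: pair_graph G by fact
  define r where "r = k + m"
  let ?H = "hypercube r"
  note H = pair_graph_hypercube[of r]
  note \<sigma> = \<sigma>[folded r_def] and X = X[folded r_def]
  have V: "pverts X = pverts G \<times> {u. length u = r}"
    by (simp add: X pverts_graph_bundle pverts_hypercube)
  have "\<exists>s e. s < r \<and> (\<forall>u. length u = r \<longrightarrow> f i (x, u) = bit_sign (u ! s + e))"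
    if "i \<in> {1..m}" "x \<in> pverts G" for i x
    using pm_eigenvector_signed_coordinate[OF G \<sigma> gap _ _ that(2), of "f i"] f[OF that(1)] X by blast
  then obtain s e where s: "\<And>i x. i \<in> {1..m} \<Longrightarrow> x \<in> pverts G \<Longrightarrow> s i x < r"
    and coord: "\<And>i x u. i \<in> {1..m} \<Longrightarrow> x \<in> pverts G \<Longrightarrow> length u = r \<Longrightarrow>
      f i (x, u) = bit_sign (u ! s i x + e i x)"
    by metis
  have hor: "f i (y, \<sigma> x y u) = f i (x, u)"
    if "i \<in> {1..m}" "(x, y) \<in> parcs G" "length u = r" for i x y u
    using pm_eigenvector_horizontally_constant[OF G \<sigma> gap _ _ G.in_arcsD1[OF that(2)] that(2,3), of "f i"]
      f[OF that(1)] X by blast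
  have \<sigma>_len: "length (\<sigma> x y u) = r" if "(x, y) \<in> parcs G" "length u = r" for x y u
    using transition_mapsD(3)[OF \<sigma> that(1)] that(2) by (simp add: pverts_hypercube)
  \<comment> \<open>A coincidence on one fibre would spread over the connected base as the relation \<open>f\<^sub>i = c f\<^sub>j\<close>.\<close>
  have distinct: "s i x \<noteq> s j x"
    if ij: "i \<in> {1..m}" "j \<in> {1..m}" "i \<noteq> j" and x: "x \<in> pverts G" for i j x
  proof
    assume eq: "s i x = s j x"
    define c where "c = bit_sign (e i x) * bit_sign (e j x)"
    have base: "\<forall>u. length u = r \<longrightarrow> f i (x, u) = c * f j (x, u)"
    proof (intro allI impI)
      fix u :: "bit list" assume u: "length u = r"
      have "c * f j (x, u) =
          bit_sign (u ! s i x) * bit_sign (e i x) * (bit_sign (e j x) * bit_sign (e j x))"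
        unfolding c_def coord[OF ij(2) x u] bit_sign_add eq by (simp only: ac_simps)
      thus "f i (x, u) = c * f j (x, u)"
        unfolding coord[OF ij(1) x u] bit_sign_add bit_sign_self_add by simp
    qed
    have "\<forall>u. length u = r \<longrightarrow> f i (y, u) = c * f j (y, u)" if "y \<in> pverts G" for y
    proof (rule connected_vertex_induct[where P = "\<lambda>y. \<forall>u. length u = r \<longrightarrow> f i (y, u) = c * f j (y, u)",
          OF G conn x that base])
      fix a b assume ab: "(a, b) \<in> parcs G" and IH: "\<forall>u. length u = r \<longrightarrow> f i (a, u) = c * f j (a, u)"
      have ba: "(b, a) \<in> parcs G" using G.pair_sym_arcs ab by (auto simp: symmetric_def dest: symD)
      show "\<forall>u. length u = r \<longrightarrow> f i (b, u) = c * f j (b, u)"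
        using IH hor[OF ij(1) ba] hor[OF ij(2) ba] \<sigma>_len[OF ba] by metis
    qed
    hence rel: "f i p = c * f j p" if "p \<in> pverts X" for p
      using that by (auto simp: V)
    define d where "d l = (if l = i then 1 else if l = j then - c else 0)" for l
    have "(\<Sum>l\<in>{1..m}. d l * f l p) = 0" if p: "p \<in> pverts X" for p
    proof -
      have "(\<Sum>l\<in>{1..m}. d l * f l p) = (\<Sum>l\<in>{i, j}. d l * f l p)"
        by (rule sum.mono_neutral_right) (use ij in \<open>auto simp: d_def\<close>)
      thus ?thesis using ij rel[OF p] by (simp add: d_def)
    qed
    hence "d i = 0" using indep ij(1) unfolding lin_indep_on_def by blast
    thus False by (simp add: d_def)
  qed
  \<comment> \<open>Position \<open>j\<close> in \<open>{k..<r}\<close> belongs to the eigenvector with index \<open>j - k + 1\<close>.\<close>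
  have "\<exists>p. bij_betw p {..<r} {..<r} \<and> (\<forall>j\<in>{k..<r}. p j = s (Suc j - k) x)" if x: "x \<in> pverts G" for x
  proof (rule extend_injection_to_permutation)
    show "inj_on (\<lambda>j. s (Suc j - k) x) {k..<r}"
    proof (rule inj_onI)
      fix a b assume ab: "a \<in> {k..<r}" "b \<in> {k..<r}" "s (Suc a - k) x = s (Suc b - k) x"
      have "Suc a - k \<in> {1..m}" "Suc b - k \<in> {1..m}" using ab by (auto simp: r_def)
      hence "Suc a - k = Suc b - k" using distinct[OF _ _ _ x] ab(3) by blast
      thus "a = b" using ab by auto
    qed
    show "(\<lambda>j. s (Suc j - k) x) ` {k..<r} \<subseteq> {..<r}"
    proof clarify
      fix j assume "j \<in> {k..<r}"
      hence "Suc j - k \<in> {1..m}" by (auto simp: r_def)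
      thus "s (Suc j - k) x < r" using s x by blast
    qed
  qed (simp add: r_def)
  then obtain p where p: "\<And>x. x \<in> pverts G \<Longrightarrow> bij_betw (p x) {..<r} {..<r}"
    and p_last: "\<And>x j. x \<in> pverts G \<Longrightarrow> j \<in> {k..<r} \<Longrightarrow> p x j = s (Suc j - k) x"
    by metis
  define \<phi> where "\<phi> x = signed_permutation r (p x) (\<lambda>j. e (Suc j - k) x)" for x
  have \<phi>: "graph_isomorphism ?H ?H (\<phi> x)" if "x \<in> pverts G" for x
    unfolding \<phi>_def by (rule graph_isomorphism_signed_permutation[OF p[OF that]])
  have \<phi>_last: "bit_sign (\<phi> x u ! j) = f (Suc j - k) (x, u)"
    if x: "x \<in> pverts G" and j: "j \<in> {k..<r}" and u: "length u = r" for x j u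
  proof -
    have "Suc j - k \<in> {1..m}" using j by (auto simp: r_def)
    from coord[OF this x u] show ?thesis
      using j by (simp add: \<phi>_def signed_permutation_def p_last[OF x j])
  qed
  define \<tau> where "\<tau> x y = \<phi> y \<circ> \<sigma> x y \<circ> inv_into (pverts ?H) (\<phi> x)" for x y
  have \<tau>: "transition_maps G ?H \<tau>"
    unfolding \<tau>_def by (rule transition_maps_change_of_coordinates[OF G \<sigma> \<phi>])
  have \<tau>_len: "length (\<tau> x y z) = r" if "(x, y) \<in> parcs G" "length z = r" for x y z
    using transition_mapsD(3)[OF \<tau> that(1)] that(2) by (simp add: pverts_hypercube)
  have \<tau>\<phi>: "\<tau> x y (\<phi> x u) = \<phi> y (\<sigma> x y u)" if "(x, y) \<in> parcs G" "length u = r" for x y u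
    using \<phi>[OF G.in_arcsD1[OF that(1)]] that(2)
    by (simp add: \<tau>_def graph_isomorphism_def bij_betw_def inv_into_f_f pverts_hypercube)
  have fix_last: "drop k (\<tau> x y z) = drop k z" if xy: "(x, y) \<in> parcs G" and z: "length z = r" for x y z
  proof -
    note x = G.in_arcsD1[OF xy] and y = G.in_arcsD2[OF xy]
    have "z \<in> \<phi> x ` {u. length u = r}"
      using \<phi>[OF x] z by (simp add: graph_isomorphism_def bij_betw_def pverts_hypercube)
    then obtain u where u: "length u = r" "z = \<phi> x u" by blast
    have "\<tau> x y z ! j = z ! j" if j: "j \<in> {k..<r}" for j
    proof -
      have "Suc j - k \<in> {1..m}" using j by (auto simp: r_def)
      from hor[OF this xy u(1)] have "bit_sign (\<tau> x y z ! j) = bit_sign (z ! j)"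
        unfolding u(2) \<tau>\<phi>[OF xy u(1)] using \<phi>_last[OF x j u(1)] \<phi>_last[OF y j \<sigma>_len[OF xy u(1)]] by simp
      thus ?thesis by (simp add: bit_sign_eq_iff)
    qed
    thus ?thesis using \<tau>_len[OF xy z] z by (intro nth_equalityI) auto
  qed
  obtain \<rho> where \<rho>: "transition_maps G (hypercube k) \<rho>"
    and ext: "\<And>x y z. (x, y) \<in> parcs G \<Longrightarrow> length z = r \<Longrightarrow> extend_transition k \<rho> x y z = \<tau> x y z"
    using restrict_transition_maps[OF G \<tau>[unfolded r_def] fix_last[unfolded r_def]]
    unfolding r_def by blast
  have "bundle_isomorphic X (graph_bundle G (extend_transition k \<rho>) ?H)"
    unfolding X
  proof (rule bundle_isomorphic_change_of_coordinates[OF G H \<sigma> \<phi>])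
    fix x y u assume xy: "(x, y) \<in> parcs G" and u: "u \<in> pverts ?H"
    have "\<phi> x u \<in> pverts ?H"
      using graph_isomorphism_in_verts[OF \<phi>[OF G.in_arcsD1[OF xy]] u] .
    thus "extend_transition k \<rho> x y (\<phi> x u) = \<phi> y (\<sigma> x y u)"
      using ext[OF xy] \<tau>\<phi>[OF xy] u by (simp add: pverts_hypercube)
  qed
  thus ?thesis using \<rho> as_cube_bundle_eq[OF \<rho>, of m] by (auto simp: r_def)
qed

theorem theorem6p9:
  fixes G' :: "'a pair_pre_digraph"
    and \<sigma> :: "'a \<Rightarrow> 'a \<Rightarrow> bit list \<Rightarrow> bit list"
    and X :: "('a \<times> bit list) pair_pre_digraph"
    and r m :: nat
  assumes "pair_graph G'"
    and "Digraph_Component.connected (with_proj G')"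
    and "lambda1 G' > 2"
    and "transition_maps G' (hypercube r) \<sigma>"
    and "X = graph_bundle G' \<sigma> (hypercube r)"
    and "1 \<le> m" and "m \<le> r"
  shows "(\<exists>\<rho>. transition_maps G' (hypercube (r - m)) \<rho> \<and>
            bundle_isomorphic X (as_cube_bundle (graph_bundle G' \<rho> (hypercube (r - m)) \<box> hypercube m)))
         \<longleftrightarrow>
         (\<exists>f :: nat \<Rightarrow> 'a \<times> bit list \<Rightarrow> real.
            lin_indep_on (pverts X) {1..m} f \<and>
            (\<forall>i \<in> {1..m}. eigenvector X 2 (f i) \<and> f i ` pverts X \<subseteq> {-1, 1}))"
proof -
  define k where "k = r - m"
  have r: "r = k + m" using \<open>m \<le> r\<close> by (simp add: k_def)
  have "pverts G' \<noteq> {}"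
    using assms(2) by (simp add: connected_def strongly_connected_def mk_symmetric_def)
  note \<sigma> = assms(4)[unfolded r] and X = assms(5)[unfolded r]
  show ?thesis (is "?split \<longleftrightarrow> ?eigenvectors")
  proof
    assume ?split
    then obtain \<rho> where "transition_maps G' (hypercube k) \<rho>"
      and "bundle_isomorphic X (as_cube_bundle (graph_bundle G' \<rho> (hypercube k) \<box> hypercube m))"
      unfolding k_def[symmetric] by (elim exE conjE)
    thus ?eigenvectors
      by (rule eigenvectors_if_cube_factor[OF assms(1) \<open>pverts G' \<noteq> {}\<close> \<sigma> _ X])
  next
    assume ?eigenvectors
    then obtain f :: "nat \<Rightarrow> 'a \<times> bit list \<Rightarrow> real" where "lin_indep_on (pverts X) {1..m} f"
      and f: "\<forall>i\<in>{1..m}. eigenvector X 2 (f i) \<and> f i ` pverts X \<subseteq> {-1, 1}"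
      by (elim exE conjE)
    from cube_factor_if_eigenvectors[OF assms(1-3) \<sigma> X this(1) bspec[OF f]]
    show ?split unfolding k_def[symmetric] .
  qed
qed

end
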